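(* Let $G$ be a dynamic graph undergoing edge insertions and deletions. Suppose there exists a data structure with (amortized or worst-case) update time $T$ maintaining a $D$-outdegree orientation of $G$. Then there exists a data structure that maintains an arboricity decomposition of $G$ with $2D$ forests and with (amortized or worst-case, respectively) update time $O(T)$.
   Context: A dynamic graph has a fixed vertex set $V$ with $|V|=n$, initially has no edges, and undergoes a sequence of updates, each inserting or deleting a single edge. A $D$-outdegree orientation of an undirected graph assigns a direction to each edge such that every vertex has outdegree at most $D$ ($D$ may vary over time, e.g. depend on a changing graph parameter; the maintained decomposition then uses $2D$ forests for the current value of $D$). An arboricity decomposition is an explicitly maintained partition of the current edge set into edge-disjoint undirected forests. *)

theory Defs
  imports Complex_Main "HOL-Library.Disjoint_Sets"
begin

section \<open>Undirected graphs, orientations and forests\<close>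

text \<open>
  An undirected simple graph is given by its set of edges, each edge being a two-element set.
\<close>

definition is_cycle :: "'a set set \<Rightarrow> 'a list \<Rightarrow> bool" where
  "is_cycle E p \<longleftrightarrow>
     3 \<le> length p \<and> distinct p \<and>
     (\<forall>i<length p. {p ! i, p ! (Suc i mod length p)} \<in> E)"

definition is_forest :: "'a set set \<Rightarrow> bool" where
  "is_forest E \<longleftrightarrow> (\<nexists>p. is_cycle E p)"

text \<open>A pair \<open>(u, v)\<close> stands for the edge between \<open>u\<close> and \<open>v\<close> directed from \<open>u\<close> to \<open>v\<close>.\<close>

definition orientation :: "'a set set \<Rightarrow> ('a \<times> 'a) set \<Rightarrow> bool" where
  "orientation E A \<longleftrightarrow>
     (\<forall>(u, v)\<in>A. {u, v} \<in> E) \<and>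
     (\<forall>u v. {u, v} \<in> E \<longrightarrow> ((u, v) \<in> A \<longleftrightarrow> (v, u) \<notin> A))"

definition outdegree_orientation :: "nat \<Rightarrow> 'a set set \<Rightarrow> ('a \<times> 'a) set \<Rightarrow> bool" where
  "outdegree_orientation d E A \<longleftrightarrow> orientation E A \<and> (\<forall>u. card (A `` {u}) \<le> d)"

definition arboricity_decomposition :: "nat \<Rightarrow> 'a set set \<Rightarrow> (nat \<Rightarrow> 'a set set) \<Rightarrow> bool" where
  "arboricity_decomposition k E F \<longleftrightarrow>
     (\<Union>i<k. F i) = E \<and> disjoint_family_on F {..<k} \<and> (\<forall>i<k. is_forest (F i))"


section \<open>Dynamic graphs\<close>

text \<open>
  The vertex set is \<open>{0..<n}\<close>. A dynamic graph is identified with its sequence of updates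
  (oldest first), starting from the graph without edges.
\<close>

datatype update = Insert nat nat | Delete nat nat

fun apply_update :: "nat set set \<Rightarrow> update \<Rightarrow> nat set set" where
  "apply_update E (Insert u v) = insert {u, v} E"
| "apply_update E (Delete u v) = E - {{u, v}}"

definition graph_after :: "update list \<Rightarrow> nat set set" where
  "graph_after us = foldl apply_update {} us"

fun legal_update :: "nat \<Rightarrow> nat set set \<Rightarrow> update \<Rightarrow> bool" where
  "legal_update n E (Insert u v) \<longleftrightarrow> u < n \<and> v < n \<and> u \<noteq> v \<and> {u, v} \<notin> E"
| "legal_update n E (Delete u v) \<longleftrightarrow> {u, v} \<in> E"

definition valid_updates :: "nat \<Rightarrow> update list \<Rightarrow> bool" where
  "valid_updates n us \<longleftrightarrow> (\<forall>i<length us. legal_update n (graph_after (take i us)) (us ! i))"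


section \<open>The machine model: unit-cost word RAM\<close>

text \<open>
  Programs of a deterministic word RAM with words of \<open>w\<close> bits, presented as structured
  three-address code. A program uses finitely many registers and finitely many arrays; both are
  named by constants in the program text, while array cells are addressed by the contents of
  registers (so every array has \<open>2 ^ w\<close> cells). Every assignment and every evaluation of a
  guard takes one unit of time.
\<close>

datatype word_op = Add | Sub | Mul | Div | Mod | Less | Eq | And | Or | Xor | Shl | Shr

fun word_op_sem :: "nat \<Rightarrow> word_op \<Rightarrow> nat \<Rightarrow> nat \<Rightarrow> nat" where
  "word_op_sem w Add x y = take_bit w (x + y)"
| "word_op_sem w Sub x y = nat (take_bit w (int x - int y))"
| "word_op_sem w Mul x y = take_bit w (x * y)"
| "word_op_sem w Div x y = take_bit w (x div y)"
| "word_op_sem w Mod x y = take_bit w (x mod y)"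
| "word_op_sem w Less x y = take_bit w (of_bool (x < y))"
| "word_op_sem w Eq x y = take_bit w (of_bool (x = y))"
| "word_op_sem w And x y = take_bit w (Bit_Operations.and x y)"
| "word_op_sem w Or x y = take_bit w (Bit_Operations.or x y)"
| "word_op_sem w Xor x y = take_bit w (Bit_Operations.xor x y)"
| "word_op_sem w Shl x y = take_bit w (push_bit y x)"
| "word_op_sem w Shr x y = take_bit w (drop_bit y x)"

type_synonym reg = nat
type_synonym arr = nat

datatype com =
    Skip
  | Const reg nat
  | Op word_op reg reg reg
  | Load reg arr reg
  | Store arr reg reg
  | Seq com com
  | If reg com com
  | While reg com

type_synonym state = "(reg \<Rightarrow> nat) \<times> (arr \<Rightarrow> nat \<Rightarrow> nat)"

text \<open>
  \<open>exec w c s t s'\<close>: started in \<open>s\<close>, program \<open>c\<close> terminates in \<open>s'\<close> after exactly \<open>t\<close> steps.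
\<close>

inductive exec :: "nat \<Rightarrow> com \<Rightarrow> state \<Rightarrow> nat \<Rightarrow> state \<Rightarrow> bool" for w :: nat where
  Skip: "exec w Skip s 1 s"
| Const: "exec w (Const r k) (R, M) 1 (R(r := take_bit w k), M)"
| Op: "exec w (Op f r a b) (R, M) 1 (R(r := word_op_sem w f (R a) (R b)), M)"
| Load: "exec w (Load r x a) (R, M) 1 (R(r := M x (R a)), M)"
| Store: "exec w (Store x a b) (R, M) 1 (R, M(x := (M x)(R a := R b)))"
| Seq: "exec w c1 s1 t1 s2 \<Longrightarrow> exec w c2 s2 t2 s3 \<Longrightarrow> exec w (Seq c1 c2) s1 (t1 + t2) s3"
| IfTrue: "fst s r \<noteq> 0 \<Longrightarrow> exec w c1 s t s' \<Longrightarrow> exec w (If r c1 c2) s (1 + t) s'"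
| IfFalse: "fst s r = 0 \<Longrightarrow> exec w c2 s t s' \<Longrightarrow> exec w (If r c1 c2) s (1 + t) s'"
| WhileFalse: "fst s r = 0 \<Longrightarrow> exec w (While r c) s 1 s"
| WhileTrue: "fst s1 r \<noteq> 0 \<Longrightarrow> exec w c s1 t1 s2 \<Longrightarrow> exec w (While r c) s2 t2 s3 \<Longrightarrow>
    exec w (While r c) s1 (1 + t1 + t2) s3"


section \<open>Dynamic data structures\<close>

text \<open>
  A data structure is a single program, the same for all \<open>n\<close>, that is run once per update.
  Initially all registers and array cells are \<open>0\<close>; they keep their contents between updates,
  except that before each run the parameters are placed in registers \<open>0\<close> to \<open>3\<close>: the number of
  vertices, the kind of update (\<open>1\<close> for an insertion, \<open>0\<close> for a deletion) and the two endpoints.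
  There is no separate preprocessing phase: one-time initialisation belongs to the first update,
  which may have a time bound of its own since bounds may depend on the update history.
\<close>

definition init_state :: state where
  "init_state = ((\<lambda>_. 0), (\<lambda>_ _. 0))"

fun call :: "nat \<Rightarrow> update \<Rightarrow> state \<Rightarrow> state" where
  "call n (Insert u v) (R, M) = (R(0 := n, 1 := 1, 2 := u, 3 := v), M)"
| "call n (Delete u v) (R, M) = (R(0 := n, 1 := 0, 2 := u, 3 := v), M)"

text \<open>
  \<open>run w P n us ts s\<close>: processing the updates \<open>us\<close> one by one takes the times \<open>ts\<close> and
  ends in state \<open>s\<close>. The word size is a function of \<open>n\<close>.
\<close>

inductive run :: "(nat \<Rightarrow> nat) \<Rightarrow> com \<Rightarrow> nat \<Rightarrow> update list \<Rightarrow> nat list \<Rightarrow> state \<Rightarrow> bool"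
  for w :: "nat \<Rightarrow> nat" and P :: com and n :: nat where
  Nil: "run w P n [] [] init_state"
| Snoc: "run w P n us ts s \<Longrightarrow> exec (w n) P (call n x s) t s' \<Longrightarrow>
    run w P n (us @ [x]) (ts @ [t]) s'"

text \<open>
  The maintained object is stored explicitly in array \<open>0\<close>, an \<open>n \<times> n\<close> table in row-major order.
  For an orientation, the entry of \<open>(u, v)\<close> is nonzero iff there is an edge directed from \<open>u\<close> to
  \<open>v\<close>. For a decomposition, the entry of \<open>(u, v)\<close> with \<open>u < v\<close> is \<open>0\<close> if there is no edge, and
  otherwise one more than the index of the forest that contains the edge.
\<close>

definition stored_orientation :: "nat \<Rightarrow> state \<Rightarrow> (nat \<times> nat) set" where
  "stored_orientation n s = {(u, v). u < n \<and> v < n \<and> snd s 0 (u * n + v) \<noteq> 0}"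

definition stored_forest :: "nat \<Rightarrow> state \<Rightarrow> nat \<Rightarrow> nat set set" where
  "stored_forest n s i = {{u, v} | u v. u < v \<and> v < n \<and> snd s 0 (u * n + v) = Suc i}"

definition maintains_orientation ::
    "(nat \<Rightarrow> nat) \<Rightarrow> com \<Rightarrow> (nat \<Rightarrow> update list \<Rightarrow> nat) \<Rightarrow> bool" where
  "maintains_orientation w P D \<longleftrightarrow>
     (\<forall>n us. valid_updates n us \<longrightarrow>
        (\<exists>ts s. run w P n us ts s \<and>
           outdegree_orientation (D n us) (graph_after us) (stored_orientation n s)))"

definition maintains_arboricity_decomposition ::
    "(nat \<Rightarrow> nat) \<Rightarrow> com \<Rightarrow> (nat \<Rightarrow> update list \<Rightarrow> nat) \<Rightarrow> bool" where
  "maintains_arboricity_decomposition w P k \<longleftrightarrow>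
     (\<forall>n us. valid_updates n us \<longrightarrow>
        (\<exists>ts s. run w P n us ts s \<and>
           arboricity_decomposition (k n us) (graph_after us) (stored_forest n s) \<and>
           (\<forall>u v. u < v \<and> v < n \<and> {u, v} \<notin> graph_after us \<longrightarrow> snd s 0 (u * n + v) = 0)))"

text \<open>
  A time bound \<open>T n us\<close> refers to the last update of the nonempty history \<open>us\<close>. For a bound
  \<open>T n\<close> that does not depend on the history, the amortized condition says that any \<open>m\<close> updates
  starting from the empty graph take total time at most \<open>m * T n\<close>.
\<close>

definition worst_case_update_time ::
    "(nat \<Rightarrow> nat) \<Rightarrow> com \<Rightarrow> (nat \<Rightarrow> update list \<Rightarrow> real) \<Rightarrow> bool" where
  "worst_case_update_time w P T \<longleftrightarrow>
     (\<forall>n us ts s. valid_updates n us \<and> run w P n us ts s \<longrightarrow>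
        (\<forall>i<length us. real (ts ! i) \<le> T n (take (Suc i) us)))"

definition amortized_update_time ::
    "(nat \<Rightarrow> nat) \<Rightarrow> com \<Rightarrow> (nat \<Rightarrow> update list \<Rightarrow> real) \<Rightarrow> bool" where
  "amortized_update_time w P T \<longleftrightarrow>
     (\<forall>n us ts s. valid_updates n us \<and> run w P n us ts s \<longrightarrow>
        real (sum_list ts) \<le> (\<Sum>i<length us. T n (take (Suc i) us)))"

text \<open>
  The machine is deterministic, so the existential quantification over runs in the maintenance
  conditions and the universal one in the time bounds concern the same, unique run.
\<close>

inductive_cases exec_elims:
  "exec w Skip s t s'"
  "exec w (Const r k) s t s'"
  "exec w (Op f r a b) s t s'"
  "exec w (Load r x a) s t s'"
  "exec w (Store x a b) s t s'"
  "exec w (Seq c1 c2) s t s'"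
  "exec w (If r c1 c2) s t s'"

inductive_cases exec_WhileE: "exec w (While r c) s t s'"

lemma exec_deterministic:
  "exec w c s t s' \<Longrightarrow> exec w c s t2 s2 \<Longrightarrow> t2 = t \<and> s2 = s'"
proof (induction arbitrary: t2 s2 rule: exec.induct)
  case Seq
  from Seq.prems show ?case by (rule exec_elims(6)) (metis Seq.IH)
next
  case IfTrue
  from IfTrue.prems show ?case by (rule exec_elims(7)) (auto simp: IfTrue.hyps(1) dest!: IfTrue.IH)
next
  case IfFalse
  from IfFalse.prems show ?case by (rule exec_elims(7)) (auto simp: IfFalse.hyps(1) dest!: IfFalse.IH)
next
  case WhileFalse
  from WhileFalse.prems show ?case by (rule exec_WhileE) (auto simp: WhileFalse.hyps)
next
  case (WhileTrue s1 r c t1 sm tw s3)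
  from WhileTrue.prems WhileTrue.hyps(1) obtain t1' sm' tw' where
    "t2 = 1 + t1' + tw'" "exec w c s1 t1' sm'" "exec w (While r c) sm' tw' s2"
    by (auto elim: exec_WhileE)
  with WhileTrue.IH show ?case by metis
qed (erule exec_elims(1-5), simp)+

lemma run_deterministic:
  "run w P n us ts s \<Longrightarrow> run w P n us ts2 s2 \<Longrightarrow> ts2 = ts \<and> s2 = s"
proof (induction arbitrary: ts2 s2 rule: run.induct)
  case Nil
  then show ?case by cases simp_all
next
  case (Snoc us ts s x t s')
  from Snoc.prems obtain ts0 s0 t0 where
    "run w P n us ts0 s0" "exec (w n) P (call n x s0) t0 s2" "ts2 = ts0 @ [t0]"
    by cases auto
  with Snoc.IH[of ts0 s0] Snoc.hyps(2) show ?case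
    using exec_deterministic by blast
qed

end

(* Every vertex numbers its out-arcs consecutively by slots. The arcs in a fixed slot that lead to a
   larger vertex form a forest, because the least vertex of a cycle would have two of them; likewise
   for the arcs that lead to a smaller vertex. So slot and direction give a decomposition into 2D
   forests, and it depends on the current outdegrees only. The new program simulates the given one
   and keeps the slots up to date at every write to the orientation table, in constant time: on a
   deletion the arc in the last slot takes over the free slot. This happens while the given program
   is in the middle of an update, where the table need not be an orientation at all. *)

theory Submission
  imports Defs
begin

section \<open>Forests\<close>

lemma is_forestI:
  fixes key :: "'a \<Rightarrow> 'b::linorder"
  assumes "\<And>e. e \<in> F \<Longrightarrow> \<exists>u. e = {u, h u} \<and> key u < key (h u)"
  shows "is_forest F"
  unfolding is_forest_def
proof
  assume "\<exists>p. is_cycle F p"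
  then obtain p where len: "3 \<le> length p" and dist: "distinct p"
    and edge: "\<And>i. i < length p \<Longrightarrow> {p ! i, p ! (Suc i mod length p)} \<in> F"
    by (auto simp: is_cycle_def)
  define m where "m = length p"
  have m: "3 \<le> m" using len by (simp add: m_def)
  obtain j where j: "j < m" and min: "\<And>i. i < m \<Longrightarrow> key (p ! j) \<le> key (p ! i)"
  proof -
    have "set p \<noteq> {}" using len by auto
    then obtain x where "x \<in> set p" "\<And>y. y \<in> set p \<Longrightarrow> key x \<le> key y"
      using arg_min_if_finite(1)[of "set p" key] arg_min_least[of "set p" _ key] by blast
    then show ?thesis
      using that by (metis in_set_conv_nth m_def nth_mem)
  qed
  have out: "p ! i = h (p ! j)" if "i < m" "{p ! j, p ! i} \<in> F" for i
  proof -
    obtain u where u: "{p ! j, p ! i} = {u, h u}" "key u < key (h u)"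
      using assms[OF \<open>{p ! j, p ! i} \<in> F\<close>] by blast
    with min[OF \<open>i < m\<close>] show ?thesis by (auto simp: doubleton_eq_iff)
  qed
  define next_i where "next_i = Suc j mod m"
  define prev_i where "prev_i = (if j = 0 then m - 1 else j - 1)"
  have prev_lt: "prev_i < m" and next_lt: "next_i < m" using j m by (auto simp: prev_i_def next_i_def)
  have "Suc prev_i mod m = j" using j m by (auto simp: prev_i_def)
  with edge[of prev_i] prev_lt have "{p ! j, p ! prev_i} \<in> F"
    by (simp add: m_def insert_commute)
  moreover have "{p ! j, p ! next_i} \<in> F" using edge[of j] j by (simp add: m_def next_i_def)
  ultimately have "p ! prev_i = p ! next_i" using out prev_lt next_lt by metis
  then have "prev_i = next_i" using dist prev_lt next_lt by (simp add: m_def nth_eq_iff_index_eq)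
  then show False using j m by (cases "Suc j = m") (auto simp: prev_i_def next_i_def split: if_splits)
qed


section \<open>Slots of out-arcs\<close>

lemma cell_eq_iff [simp]:
  fixes n u v u' v' :: nat
  assumes "v < n" "v' < n"
  shows "u * n + v = u' * n + v' \<longleftrightarrow> u = u' \<and> v = v'"
proof
  assume eq: "u * n + v = u' * n + v'"
  have "(u * n + v) div n = u" "(u' * n + v') div n = u'" using assms by simp_all
  with eq show "u = u' \<and> v = v'" by auto
qed simp

lemma cell_less:
  fixes n u v :: nat
  assumes "u < n" "v < n"
  shows "u * n + v < n * n"
proof -
  have "u * n + v < Suc u * n" using assms by simp
  also have "\<dots> \<le> n * n" using assms by (intro mult_right_mono) auto
  finally show ?thesis .
qed

text \<open>
  \<open>G u\<close> is the number of arcs leaving \<open>u\<close>, which occupy the slots \<open>1\<close> to \<open>G u\<close>;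
  \<open>P (u * n + v)\<close> is the slot of the arc from \<open>u\<close> to \<open>v\<close>, or \<open>0\<close> if there is none, and
  \<open>L (u * n + i)\<close> is the head of the arc in slot \<open>i\<close> of \<open>u\<close>.
\<close>

definition slots :: "nat \<Rightarrow> (nat \<Rightarrow> nat) \<Rightarrow> (nat \<Rightarrow> nat) \<Rightarrow> (nat \<Rightarrow> nat) \<Rightarrow> bool" where
  "slots n P L G \<longleftrightarrow>
     (\<forall>u<n. \<forall>v<n. P (u * n + v) \<noteq> 0 \<longrightarrow>
        u \<noteq> v \<and> P (u * n + v) \<le> G u \<and> L (u * n + P (u * n + v)) = v) \<and>
     (\<forall>u<n. \<forall>i. 1 \<le> i \<longrightarrow> i \<le> G u \<longrightarrow> L (u * n + i) < n \<and> P (u * n + L (u * n + i)) = i)"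

lemma slotsD:
  assumes "slots n P L G" "u < n"
  shows "v < n \<Longrightarrow> P (u * n + v) \<noteq> 0 \<Longrightarrow> u \<noteq> v"
    and "v < n \<Longrightarrow> P (u * n + v) \<le> G u"
    and "v < n \<Longrightarrow> P (u * n + v) \<noteq> 0 \<Longrightarrow> L (u * n + P (u * n + v)) = v"
    and "1 \<le> i \<Longrightarrow> i \<le> G u \<Longrightarrow> L (u * n + i) < n"
    and "1 \<le> i \<Longrightarrow> i \<le> G u \<Longrightarrow> P (u * n + L (u * n + i)) = i"
  using assms unfolding slots_def by (metis (no_types) le0)+

lemma slots_degree_le_card:
  assumes "slots n P L G" "u < n"
  shows "G u \<le> card {v. v < n \<and> P (u * n + v) \<noteq> 0}"
proof -
  have "inj_on (\<lambda>i. L (u * n + i)) {1..G u}"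
    by (rule inj_on_inverseI[where g = "\<lambda>v. P (u * n + v)"]) (use slotsD(5)[OF assms] in auto)
  moreover have "(\<lambda>i. L (u * n + i)) ` {1..G u} \<subseteq> {v. v < n \<and> P (u * n + v) \<noteq> 0}"
    using slotsD(4,5)[OF assms] by fastforce
  ultimately show ?thesis
    using card_inj_on_le[of "\<lambda>i. L (u * n + i)" "{1..G u}" "{v. v < n \<and> P (u * n + v) \<noteq> 0}"]
    by simp
qed

lemma slots_degree_less:
  assumes "slots n P L G" "u < n"
  shows "G u < n"
proof -
  have "{v. v < n \<and> P (u * n + v) \<noteq> 0} \<subset> {..<n}"
    using slotsD(1)[OF assms] assms(2) by blast
  then have "card {v. v < n \<and> P (u * n + v) \<noteq> 0} < n"
    using psubset_card_mono[of "{..<n}" "{v. v < n \<and> P (u * n + v) \<noteq> 0}"] by simp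
  then show ?thesis using slots_degree_le_card[OF assms] by simp
qed

lemma slots_less:
  assumes "slots n P L G" "u < n" "v < n"
  shows "P (u * n + v) < n"
  using slotsD(2)[OF assms] slots_degree_less[OF assms(1,2)] by simp

lemma slots_insert_degree_less:
  assumes "slots n P L G" "u < n" "v < n" "u \<noteq> v" "P (u * n + v) = 0"
  shows "Suc (G u) < n"
proof -
  have "{v. v < n \<and> P (u * n + v) \<noteq> 0} \<subseteq> {..<n} - {u, v}"
    using slotsD(1)[OF assms(1,2)] assms by auto
  then have "card {v. v < n \<and> P (u * n + v) \<noteq> 0} \<le> n - 2"
    using card_mono[of "{..<n} - {u, v}" "{v. v < n \<and> P (u * n + v) \<noteq> 0}"] assms
    by (simp add: card_Diff_subset)
  then show ?thesis using slots_degree_le_card[OF assms(1,2)] assms by simp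
qed

lemma slots_insert:
  assumes S: "slots n P L G" and uv: "u < n" "v < n" "u \<noteq> v" "P (u * n + v) = 0"
  shows "slots n (P(u * n + v := Suc (G u))) (L(u * n + Suc (G u) := v)) (G(u := Suc (G u)))"
proof -
  define k where "k = Suc (G u)"
  have k: "k < n" "\<And>i. i \<le> k \<longleftrightarrow> i = k \<or> i \<le> G u" "G u < k" "1 \<le> k" "k \<noteq> 0"
    using slots_insert_degree_less[OF S uv] by (auto simp: k_def)
  have old: "P (u * n + b) \<noteq> k" if "b < n" for b
    using slotsD(2)[OF S uv(1) that] k(3) by simp
  show ?thesis
    unfolding slots_def k_def[symmetric]
  proof (intro conjI allI impI, goal_cases)
    case (1 a b)
    then show ?case using uv slotsD(1)[OF S] by (auto split: if_splits)
  next
    case (2 a b)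
    then show ?case using uv k(2) slotsD(2)[OF S, of a b] by (auto split: if_splits)
  next
    case (3 a b)
    then show ?case
      using uv k(1) old[of b] slotsD(3)[OF S, of a b] slots_less[OF S, of a b]
      by (auto split: if_splits)
  next
    case (4 a i)
    then have "i < n" using k(1) slots_degree_less[OF S, of a] by (auto split: if_splits)
    with 4 show ?case using uv k(1,2) slotsD(4)[OF S, of a i] by (auto split: if_splits)
  next
    case (5 a i)
    then have "i < n" using k(1) slots_degree_less[OF S, of a] by (auto split: if_splits)
    show ?case
    proof (cases "a = u \<and> i = k")
      case True
      then show ?thesis using uv by simp
    next
      case False
      then have "i \<le> G a" using 5 k(2) by (auto split: if_splits)
      then have i: "L (a * n + i) < n" "P (a * n + L (a * n + i)) = i"
        using slotsD(4,5)[OF S] 5 by auto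
      then have "a = u \<Longrightarrow> L (a * n + i) \<noteq> v" using 5 uv(4) by auto
      then show ?thesis using False i uv k(1) \<open>i < n\<close> by auto
    qed
  qed
qed

text \<open>The arc in the last slot moves into the slot that becomes free.\<close>

lemma slots_delete:
  assumes S: "slots n P L G" and uv: "u < n" "v < n" "P (u * n + v) \<noteq> 0"
  defines "x \<equiv> L (u * n + G u)"
  shows "slots n (P(u * n + x := P (u * n + v), u * n + v := 0))
    (L(u * n + P (u * n + v) := x)) (G(u := G u - 1))"
proof -
  define p where "p = P (u * n + v)"
  have p: "1 \<le> p" "p \<le> G u" "p < n" "L (u * n + p) = v"
    using slotsD(2,3)[OF S uv(1,2)] slots_less[OF S uv(1,2)] uv(3) by (auto simp: p_def)
  have x: "x < n" "P (u * n + x) = G u" using slotsD(4,5)[OF S uv(1)] p by (auto simp: x_def)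
  have "x \<noteq> u" using slotsD(1)[OF S uv(1) x(1)] x p by auto
  have xv: "x = v \<longleftrightarrow> p = G u" using p x by (auto simp: x_def p_def)
  show ?thesis
    unfolding slots_def p_def[symmetric]
  proof (intro conjI allI impI, goal_cases)
    case (1 a b)
    then show ?case using uv x \<open>x \<noteq> u\<close> slotsD(1)[OF S] by (auto split: if_splits)
  next
    case (2 a b)
    have "b \<noteq> x \<Longrightarrow> a = u \<Longrightarrow> P (a * n + b) \<noteq> 0 \<Longrightarrow> P (a * n + b) \<noteq> G u"
      using slotsD(3)[OF S uv(1), of b] 2 by (auto simp: x_def)
    moreover have "b = x \<Longrightarrow> a = u \<Longrightarrow> b \<noteq> v \<Longrightarrow> p \<noteq> G u" using xv by simp
    moreover have "P (a * n + b) \<le> G a" using slotsD(2)[OF S] 2 by simp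
    ultimately show ?case using 2 uv p x(1) by (auto split: if_splits)
  next
    case (3 a b)
    then show ?case using uv p x xv slotsD(2,3)[OF S, of a b] slots_less[OF S, of a b]
      by (auto split: if_splits)
  next
    case (4 a i)
    then have "i \<le> G a" by (auto split: if_splits)
    with 4 show ?case using uv p x slotsD(4)[OF S, of a i] slots_degree_less[OF S, of a]
      by auto
  next
    case (5 a i)
    have le: "i \<le> G a" and last: "a = u \<Longrightarrow> i \<noteq> G u" using 5 p by (auto split: if_splits)
    have "i < n" using le slots_degree_less[OF S \<open>a < n\<close>] by simp
    have i: "L (a * n + i) < n" "P (a * n + L (a * n + i)) = i" using slotsD(4,5)[OF S] 5 le by auto
    show ?case
    proof (cases "a = u \<and> i = p")
      case True
      then show ?thesis using 5 p x xv last uv by simp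
    next
      case False
      then have "a = u \<Longrightarrow> L (a * n + i) \<noteq> x \<and> L (a * n + i) \<noteq> v"
        using i(2) x(2) last p_def by auto
      then show ?thesis using False i p x(1) uv \<open>i < n\<close> by auto
    qed
  qed
qed


section \<open>Programs\<close>

fun straight :: "com \<Rightarrow> bool" where
  "straight (Seq c1 c2) \<longleftrightarrow> straight c1 \<and> straight c2"
| "straight (If r c1 c2) \<longleftrightarrow> straight c1 \<and> straight c2"
| "straight (While r c) \<longleftrightarrow> False"
| "straight c \<longleftrightarrow> True"

fun result :: "nat \<Rightarrow> com \<Rightarrow> state \<Rightarrow> state" where
  "result w (Const r k) (R, M) = (R(r := take_bit w k), M)"
| "result w (Op f r a b) (R, M) = (R(r := word_op_sem w f (R a) (R b)), M)"
| "result w (Load r x a) (R, M) = (R(r := M x (R a)), M)"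
| "result w (Store x a b) (R, M) = (R, M(x := (M x)(R a := R b)))"
| "result w (Seq c1 c2) s = result w c2 (result w c1 s)"
| "result w (If r c1 c2) s = (if fst s r \<noteq> 0 then result w c1 s else result w c2 s)"
| "result w c s = s"

fun cost :: "com \<Rightarrow> nat" where
  "cost (Seq c1 c2) = cost c1 + cost c2"
| "cost (If r c1 c2) = 1 + max (cost c1) (cost c2)"
| "cost c = 1"

lemma exec_straight: "straight c \<Longrightarrow> \<exists>t \<le> cost c. exec w c s t (result w c s)"
proof (induction c arbitrary: s)
  case (Seq c1 c2)
  obtain t1 where "t1 \<le> cost c1" "exec w c1 s t1 (result w c1 s)"
    using Seq.IH(1)[of s] Seq.prems by auto
  moreover obtain t2 where "t2 \<le> cost c2" "exec w c2 (result w c1 s) t2 (result w c2 (result w c1 s))"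
    using Seq.IH(2)[of "result w c1 s"] Seq.prems by auto
  ultimately show ?case by (auto intro!: exI[of _ "t1 + t2"] exec.Seq)
next
  case (If r c1 c2)
  show ?case
  proof (cases "fst s r = 0")
    case True
    obtain t where "t \<le> cost c2" "exec w c2 s t (result w c2 s)"
      using If.IH(2)[of s] If.prems by auto
    with True show ?thesis
      by (intro exI[of _ "1 + t"]) (simp add: exec.IfFalse[where t = t, simplified])
  next
    case False
    obtain t where "t \<le> cost c1" "exec w c1 s t (result w c1 s)"
      using If.IH(1)[of s] If.prems by auto
    with False show ?thesis
      by (intro exI[of _ "1 + t"]) (simp add: exec.IfTrue[where t = t, simplified])
  qed
next
  case (While r c)
  then show ?case by simp
qed ((intro exI[of _ 1] conjI, simp, case_tac s, simp only: result.simps, rule exec.intros)+)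

definition bounded_state :: "nat \<Rightarrow> state \<Rightarrow> bool" where
  "bounded_state w s \<longleftrightarrow> (\<forall>r. fst s r < 2 ^ w) \<and> (\<forall>x a. snd s x a < 2 ^ w)"

lemma word_op_sem_less: "word_op_sem w f x y < 2 ^ w"
  by (cases f) (auto simp: nat_less_iff simp flip: of_nat_power
      simp del: take_bit_and take_bit_or take_bit_xor)

lemma exec_bounded: "exec w c s t s' \<Longrightarrow> bounded_state w s \<Longrightarrow> bounded_state w s'"
  by (induction rule: exec.induct) (auto simp: bounded_state_def word_op_sem_less)

text \<open>
  Entry of \<open>{u, v}\<close>, \<open>u < v\<close>, in the table of the decomposition, i.e. one more than the forest
  index, which is \<open>2 * i\<close> for an upward and \<open>2 * i + 1\<close> for a downward arc in slot \<open>Suc i\<close>.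
  While an update is being processed both \<open>(u, v)\<close> and \<open>(v, u)\<close> may be stored as arcs.
\<close>

definition colour :: "nat \<Rightarrow> (nat \<Rightarrow> nat) \<Rightarrow> nat \<Rightarrow> nat \<Rightarrow> nat" where
  "colour n P u v = (if P (u * n + v) \<noteq> 0 then 2 * P (u * n + v) - 1 else 2 * P (v * n + u))"

abbreviation seq_com (infixr ";;" 55) where "c1 ;; c2 \<equiv> Seq c1 c2"

text \<open>
  The simulating program keeps the parameters in registers \<open>0\<close> to \<open>3\<close> and uses registers
  \<open>4\<close> to \<open>15\<close> as scratch space; register \<open>r\<close> of the given program becomes register \<open>r + 16\<close>.
  Arrays \<open>0\<close> to \<open>3\<close> hold the colours and the tables \<open>P\<close>, \<open>L\<close>, \<open>G\<close>; array \<open>x\<close> of the given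
  program becomes array \<open>x + 4\<close>.
\<close>

definition recolour_ordered :: "reg \<Rightarrow> reg \<Rightarrow> com" where
  "recolour_ordered lo hi =
     Const 7 1 ;; Op Mul 9 lo 0 ;; Op Add 9 9 hi ;; Load 10 1 9 ;;
     If 10 (Op Add 10 10 10 ;; Op Sub 10 10 7)
       (Op Mul 10 hi 0 ;; Op Add 10 10 lo ;; Load 10 1 10 ;; Op Add 10 10 10) ;;
     Store 0 9 10"

definition recolour :: "reg \<Rightarrow> reg \<Rightarrow> com" where
  "recolour a b = Op Less 6 a b ;; If 6 (recolour_ordered a b) (recolour_ordered b a)"

text \<open>
  The arc goes from register \<open>4\<close> to register \<open>5\<close>; \<open>unlink_arc\<close> expects its slot in register
  \<open>11\<close> and leaves in register \<open>12\<close> the head of the arc that was moved.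
\<close>

definition link_arc :: com where
  "link_arc =
     Const 7 1 ;; Load 8 3 4 ;; Op Add 8 8 7 ;; Store 3 4 8 ;;
     Op Mul 9 4 0 ;; Op Add 10 9 8 ;; Store 2 10 5 ;;
     Op Add 10 9 5 ;; Store 1 10 8"

definition unlink_arc :: com where
  "unlink_arc =
     Load 8 3 4 ;; Op Mul 9 4 0 ;; Op Add 10 9 8 ;; Load 12 2 10 ;;
     Op Add 10 9 11 ;; Store 2 10 12 ;; Op Add 10 9 12 ;; Store 1 10 11 ;;
     Op Add 10 9 5 ;; Const 7 0 ;; Store 1 10 7 ;;
     Const 7 1 ;; Op Sub 8 8 7 ;; Store 3 4 8"

text \<open>
  Run before the given program stores the contents of \<open>b\<close> at address \<open>a\<close> of its orientation.
  Diagonal entries are ignored, which bounds all slots by \<open>n - 1\<close>; this makes the colours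
  fit into a word even if \<open>n = 2\<close> and \<open>w = 2\<close>.
\<close>

definition store_hook :: "reg \<Rightarrow> reg \<Rightarrow> com" where
  "store_hook a b =
     Op Div 4 a 0 ;; Op Mod 5 a 0 ;; Op Less 6 4 0 ;;
     If 6 (Op Eq 6 4 5 ;; If 6 Skip
       (Load 11 1 a ;;
        If b (If 11 Skip (link_arc ;; recolour 4 5))
          (If 11 (unlink_arc ;; recolour 4 12 ;; recolour 4 5) Skip)))
       Skip"

definition consistent :: "nat \<Rightarrow> (arr \<Rightarrow> nat \<Rightarrow> nat) \<Rightarrow> bool" where
  "consistent n M \<longleftrightarrow>
     slots n (M 1) (M 2) (M 3) \<and>
     (\<forall>u<n. \<forall>v<n. M 1 (u * n + v) \<noteq> 0 \<longleftrightarrow> u \<noteq> v \<and> M 4 (u * n + v) \<noteq> 0) \<and>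
     (\<forall>u v. u < v \<longrightarrow> v < n \<longrightarrow> M 0 (u * n + v) = colour n (M 1) u v)"

lemma colour_cong:
  "P (u * n + v) = P' (u * n + v) \<Longrightarrow> P (v * n + u) = P' (v * n + u) \<Longrightarrow>
    colour n P u v = colour n P' u v"
  by (simp add: colour_def)

fun simulate :: "com \<Rightarrow> com" where
  "simulate Skip = Skip"
| "simulate (Const r k) = Const (r + 16) k"
| "simulate (Op f r a b) = Op f (r + 16) (a + 16) (b + 16)"
| "simulate (Load r x a) = Load (r + 16) (x + 4) (a + 16)"
| "simulate (Store x a b) =
     (if x = 0 then store_hook (a + 16) (b + 16) else Skip) ;; Store (x + 4) (a + 16) (b + 16)"
| "simulate (Seq c1 c2) = simulate c1 ;; simulate c2"
| "simulate (If r c1 c2) = If (r + 16) (simulate c1) (simulate c2)"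
| "simulate (While r c) = While (r + 16) (simulate c)"

definition simulated_state :: "state \<Rightarrow> state" where
  "simulated_state s = (\<lambda>r. fst s (r + 16), \<lambda>x. snd s (x + 4))"

definition good_state :: "nat \<Rightarrow> nat \<Rightarrow> state \<Rightarrow> bool" where
  "good_state w n s \<longleftrightarrow> bounded_state w s \<and> consistent n (snd s)"

lemma straight_store_hook: "straight (store_hook a b)"
  by (simp add: store_hook_def link_arc_def unlink_arc_def recolour_def recolour_ordered_def)

lemma cost_store_hook: "cost (store_hook a b) \<le> 70"
  by (simp add: store_hook_def link_arc_def unlink_arc_def recolour_def recolour_ordered_def)

lemma consistent_fun_upd: "4 < x \<Longrightarrow> consistent n (M(x := f)) \<longleftrightarrow> consistent n M"
  by (simp add: consistent_def)

lemma exec_time_pos: "exec w c s t s' \<Longrightarrow> 1 \<le> t"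
  by (induction rule: exec.induct) auto


section \<open>Correctness of the simulation\<close>

context
  fixes n w :: nat
  assumes n2: "2 \<le> n" and word_size: "n * n \<le> 2 ^ w"
begin

lemma take_bit_cell: "x < n * n \<Longrightarrow> take_bit w x = x"
  using word_size by (simp add: take_bit_nat_eq_self)

lemma take_bit_cells:
  assumes "u < n" "v < n"
  shows "take_bit w (u * n + v) = u * n + v" "take_bit w (u * n) = u * n"
  using cell_less[OF assms] assms by (auto intro!: take_bit_cell)

lemma word_size_pos: "0 < w"
proof (rule ccontr)
  assume "\<not> 0 < w"
  then have "n * n \<le> 1" using word_size by simp
  moreover have "2 * 2 \<le> n * n" using n2 by (intro mult_le_mono)
  ultimately show False by simp
qed

lemma n_less_word: "n < 2 ^ w"
proof -
  have "n * 2 \<le> n * n" using n2 by simp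
  with n2 word_size show ?thesis by linarith
qed

lemma take_bit_small: "x \<le> n \<Longrightarrow> take_bit w x = x"
  using n_less_word by (simp add: take_bit_nat_eq_self)

lemma take_bit_bool [simp]: "take_bit w (of_bool b) = (of_bool b :: nat)" "take_bit w (Suc 0) = Suc 0"
  using word_size_pos by (cases b; simp add: take_bit_small[of 1, simplified] n2)+

lemma take_bit_double: "x < n \<Longrightarrow> take_bit w (x + x) = x + x"
proof -
  assume "x < n"
  have "n * 2 \<le> n * n" using n2 by simp
  with \<open>x < n\<close> have "x + x < n * n" by linarith
  then show ?thesis by (rule take_bit_cell)
qed

lemma sub_word: "y \<le> x \<Longrightarrow> x < 2 ^ w \<Longrightarrow> word_op_sem w Sub x y = x - y"
  by (simp add: take_bit_int_eq_self flip: of_nat_diff of_nat_power)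

lemma result_recolour_ordered:
  assumes "R 0 = n" "R a < R b" "R b < n"
    and ab: "a \<notin> {6, 7, 9, 10}" "b \<notin> {6, 7, 9, 10}"
    and P: "\<And>u v. u < n \<Longrightarrow> v < n \<Longrightarrow> M 1 (u * n + v) < n"
  shows "\<exists>R'. result w (recolour_ordered a b) (R, M) =
      (R', M(0 := (M 0)(R a * n + R b := colour n (M 1) (R a) (R b)))) \<and>
      (\<forall>r. r \<notin> {6, 7, 9, 10} \<longrightarrow> R' r = R r)"
proof -
  have lt: "R a < n" using assms by simp
  have tb: "take_bit w (R a * n) = R a * n" "take_bit w (R b * n) = R b * n"
    "take_bit w (R a * n + R b) = R a * n + R b" "take_bit w (R b * n + R a) = R b * n + R a"
    using lt assms(3) by (simp_all add: take_bit_cells)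
  define p where "p = M 1 (R a * n + R b)"
  define q where "q = M 1 (R b * n + R a)"
  have dbl: "take_bit w (p + p) = p + p" "take_bit w (q + q) = q + q"
    using take_bit_double P lt assms(3) by (auto simp: p_def q_def)
  have "p + p < 2 ^ w" using dbl(1) take_bit_nat_less_exp[of w "p + p"] by simp
  then have sub: "p \<noteq> 0 \<Longrightarrow> word_op_sem w Sub (p + p) (Suc 0) = 2 * p - 1"
    by (subst sub_word) auto
  show ?thesis
  proof (cases "p = 0")
    case True
    with assms(1) ab tb dbl show ?thesis
      by (auto simp: recolour_ordered_def colour_def p_def q_def mult_2)
  next
    case False
    with assms(1) ab tb dbl sub show ?thesis
      using take_bit_bool
      by (auto simp: recolour_ordered_def colour_def p_def q_def simp del: word_op_sem.simps(2))
  qed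
qed

lemma result_recolour:
  assumes "R 0 = n" "R a \<noteq> R b" "R a < n" "R b < n"
    and ab: "a \<notin> {6, 7, 9, 10}" "b \<notin> {6, 7, 9, 10}"
    and P: "\<And>u v. u < n \<Longrightarrow> v < n \<Longrightarrow> M 1 (u * n + v) < n"
  shows "\<exists>R'. result w (recolour a b) (R, M) =
      (R', M(0 := (M 0)(min (R a) (R b) * n + max (R a) (R b) :=
         colour n (M 1) (min (R a) (R b)) (max (R a) (R b))))) \<and>
      (\<forall>r. r \<notin> {6, 7, 9, 10} \<longrightarrow> R' r = R r)"
proof (cases "R a < R b")
  case True
  then show ?thesis
    using result_recolour_ordered[of "R(6 := 1)" a b M] assms take_bit_bool
    by (auto simp: recolour_def min_def max_def)
next
  case False
  then show ?thesis
    using result_recolour_ordered[of "R(6 := 0)" b a M] assms take_bit_bool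
    by (auto simp: recolour_def min_def max_def)
qed

lemma result_link_arc:
  assumes "R 0 = n" "R 4 < n" "R 5 < n" "Suc (M 3 (R 4)) < n"
  shows "\<exists>R'. result w link_arc (R, M) =
      (R', M(3 := (M 3)(R 4 := Suc (M 3 (R 4))),
         2 := (M 2)(R 4 * n + Suc (M 3 (R 4)) := R 5),
         1 := (M 1)(R 4 * n + R 5 := Suc (M 3 (R 4))))) \<and>
      (\<forall>r. r \<notin> {7, 8, 9, 10} \<longrightarrow> R' r = R r)"
proof -
  have "take_bit w (R 4 * n) = R 4 * n" "take_bit w (R 4 * n + R 5) = R 4 * n + R 5"
    "take_bit w (Suc (R 4 * n + M 3 (R 4))) = Suc (R 4 * n + M 3 (R 4))"
    "take_bit w (Suc (M 3 (R 4))) = Suc (M 3 (R 4))"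
    using take_bit_cells[OF assms(2,3)] take_bit_cells[OF assms(2,4)]
      take_bit_small assms(4) by simp_all
  then show ?thesis
    using assms(1) take_bit_bool by (auto simp: link_arc_def)
qed

lemma result_unlink_arc:
  assumes "R 0 = n" "R 4 < n" "R 5 < n" "R 11 < n"
    and "M 3 (R 4) < n" "M 3 (R 4) \<noteq> 0" "x = M 2 (R 4 * n + M 3 (R 4))" "x < n"
  shows "\<exists>R'. result w unlink_arc (R, M) =
      (R', M(2 := (M 2)(R 4 * n + R 11 := x),
         1 := (M 1)(R 4 * n + x := R 11, R 4 * n + R 5 := 0),
         3 := (M 3)(R 4 := M 3 (R 4) - 1))) \<and>
      R' 12 = x \<and> (\<forall>r. r \<notin> {7, 8, 9, 10, 12} \<longrightarrow> R' r = R r)"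
proof -
  have "take_bit w (R 4 * n) = R 4 * n"
    "take_bit w (R 4 * n + R 5) = R 4 * n + R 5"
    "take_bit w (R 4 * n + R 11) = R 4 * n + R 11"
    "take_bit w (R 4 * n + M 3 (R 4)) = R 4 * n + M 3 (R 4)"
    "take_bit w (R 4 * n + x) = R 4 * n + x"
    using assms by (simp_all add: take_bit_cells)
  moreover have "word_op_sem w Sub (M 3 (R 4)) (Suc 0) = M 3 (R 4) - 1"
    using assms n_less_word by (subst sub_word) auto
  ultimately show ?thesis
    using assms(1,7)[symmetric] take_bit_bool
    by (auto simp: unlink_arc_def simp del: word_op_sem.simps(2))
qed

lemma result_store_hook:
  assumes R0: "R 0 = n" and Ra: "R a < 2 ^ w" and ab: "16 \<le> a" "16 \<le> b"
    and cons: "consistent n M"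
  shows "\<exists>R' M'. result w (store_hook a b) (R, M) = (R', M') \<and>
    (\<forall>r. r \<notin> {4..<16} \<longrightarrow> R' r = R r) \<and> (\<forall>x\<ge>4. M' x = M x) \<and>
    consistent n (M'(4 := (M 4)(R a := R b)))"
proof -
  define u where "u = R a div n"
  define v where "v = R a mod n"
  have v: "v < n" using n2 by (simp add: v_def)
  have addr: "R a = u * n + v" by (simp add: u_def v_def)
  have words: "take_bit w u = u" "take_bit w v = v"
    using le_less_trans[OF div_le_dividend Ra, of n] n_less_word v
    by (simp_all add: u_def take_bit_nat_eq_self)
  define p where "p = M 1 (R a)"
  define R1 where "R1 = R(4 := u, 5 := v, 6 := 0, 11 := p)"
  have S: "slots n (M 1) (M 2) (M 3)"
    and arcs: "\<And>a b. a < n \<Longrightarrow> b < n \<Longrightarrow> M 1 (a * n + b) \<noteq> 0 \<longleftrightarrow> a \<noteq> b \<and> M 4 (a * n + b) \<noteq> 0"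
    and col: "\<And>a b. a < b \<Longrightarrow> b < n \<Longrightarrow> M 0 (a * n + b) = colour n (M 1) a b"
    using cons by (auto simp: consistent_def)
  have pre: "result w (store_hook a b) (R, M) =
    (if u < n then if u = v then (R(4 := u, 5 := v, 6 := 1), M)
       else if R b \<noteq> 0 then if p \<noteq> 0 then (R1, M) else result w (link_arc ;; recolour 4 5) (R1, M)
       else if p \<noteq> 0 then result w (unlink_arc ;; recolour 4 12 ;; recolour 4 5) (R1, M) else (R1, M)
     else (R(4 := u, 5 := v, 6 := 0), M))"
    using R0 ab words take_bit_bool
    by (simp add: store_hook_def R1_def p_def flip: u_def v_def)
  consider (ignored) "\<not> u < n \<or> u = v \<or> (R b \<noteq> 0 \<longleftrightarrow> p \<noteq> 0)"
    | (link) "u < n" "u \<noteq> v" "R b \<noteq> 0" "p = 0"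
    | (unlink) "u < n" "u \<noteq> v" "R b = 0" "p \<noteq> 0"
    by blast
  then show ?thesis
  proof cases
    case ignored
    have "M 1 (c * n + d) \<noteq> 0 \<longleftrightarrow> c \<noteq> d \<and> ((M 4)(R a := R b)) (c * n + d) \<noteq> 0"
      if "c < n" "d < n" for c d
      using ignored that v arcs[OF that] by (auto simp: addr p_def)
    then have "consistent n (M(4 := (M 4)(R a := R b)))"
      using S col by (simp add: consistent_def)
    with ignored show ?thesis by (auto simp: pre R1_def)
  next
    case link
    have p0: "M 1 (u * n + v) = 0" using link by (simp add: p_def addr)
    define g where "g = Suc (M 3 u)"
    define M1 where "M1 = M(3 := (M 3)(u := g), 2 := (M 2)(u * n + g := v), 1 := (M 1)(u * n + v := g))"
    have "g < n" unfolding g_def by (rule slots_insert_degree_less[OF S link(1) v link(2) p0])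
    have S': "slots n (M1 1) (M1 2) (M1 3)"
      using slots_insert[OF S link(1) v link(2) p0] by (simp add: M1_def g_def)
    obtain R2 where R2: "result w link_arc (R1, M) = (R2, M1)"
      "\<And>r. r \<notin> {7, 8, 9, 10} \<Longrightarrow> R2 r = R1 r"
      using result_link_arc[of R1 M] R0 link(1) v \<open>g < n\<close>
      by (auto simp: R1_def M1_def g_def)
    obtain R3 where R3: "result w (recolour 4 5) (R2, M1) =
        (R3, M1(0 := (M1 0)(min u v * n + max u v := colour n (M1 1) (min u v) (max u v))))"
      "\<And>r. r \<notin> {6, 7, 9, 10} \<Longrightarrow> R3 r = R2 r"
      using result_recolour[of R2 4 5 M1] R0 R2(2) link(1,2) v slots_less[OF S']
      by (auto simp: R1_def)
    define M2 where "M2 = M1(0 := (M1 0)(min u v * n + max u v := colour n (M1 1) (min u v) (max u v)))"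
    have "consistent n (M2(4 := (M 4)(R a := R b)))"
      unfolding consistent_def
    proof (intro conjI allI impI)
      show "slots n ((M2(4 := (M 4)(R a := R b))) 1) ((M2(4 := (M 4)(R a := R b))) 2)
          ((M2(4 := (M 4)(R a := R b))) 3)"
        using S' by (simp add: M2_def)
    next
      fix c d assume cd: "c < n" "d < n"
      show "(M2(4 := (M 4)(R a := R b))) 1 (c * n + d) \<noteq> 0 \<longleftrightarrow>
          c \<noteq> d \<and> (M2(4 := (M 4)(R a := R b))) 4 (c * n + d) \<noteq> 0"
        using arcs[OF cd] cd v link by (auto simp: M2_def M1_def addr g_def)
    next
      fix c d assume cd: "c < d" "d < n"
      show "(M2(4 := (M 4)(R a := R b))) 0 (c * n + d) =
          colour n ((M2(4 := (M 4)(R a := R b))) 1) c d"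
      proof (cases "c = min u v \<and> d = max u v")
        case True
        then show ?thesis by (simp add: M2_def)
      next
        case False
        then have "colour n (M1 1) c d = colour n (M 1) c d"
          using cd v link(1) by (intro colour_cong) (auto simp: M1_def min_def max_def)
        moreover have "M2 0 (c * n + d) = M 0 (c * n + d)"
          using False cd v link(1) by (auto simp: M2_def M1_def)
        ultimately show ?thesis using col[OF cd] by (simp add: M2_def)
      qed
    qed
    moreover have "result w (store_hook a b) (R, M) = (R3, M2)"
      using link by (simp add: pre R2(1) R3(1) M2_def)
    moreover have "\<forall>r. r \<notin> {4..<16} \<longrightarrow> R3 r = R r"
      by (auto simp: R3(2) R2(2) R1_def)
    moreover have "\<forall>x\<ge>4. M2 x = M x" by (simp add: M2_def M1_def)
    ultimately show ?thesis by blast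
  next
    case unlink
    have p0: "M 1 (u * n + v) = p" by (simp add: p_def addr)
    define x where "x = M 2 (u * n + M 3 u)"
    define M1 where "M1 = M(2 := (M 2)(u * n + p := x),
      1 := (M 1)(u * n + x := p, u * n + v := 0), 3 := (M 3)(u := M 3 u - 1))"
    have p: "p < n" "1 \<le> M 3 u"
      using slots_less[OF S unlink(1) v] slotsD(2)[OF S unlink(1) v] unlink(4) p0 by auto
    have x: "x < n" "M 1 (u * n + x) = M 3 u"
      using slotsD(4,5)[OF S unlink(1) p(2)] by (auto simp: x_def)
    have "x \<noteq> u" using slotsD(1)[OF S unlink(1) x(1)] x p by auto
    have S': "slots n (M1 1) (M1 2) (M1 3)"
      using slots_delete[OF S unlink(1) v] unlink(4) p0 by (simp add: M1_def x_def)
    obtain R2 where R2: "result w unlink_arc (R1, M) = (R2, M1)" "R2 12 = x"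
      "\<And>r. r \<notin> {7, 8, 9, 10, 12} \<Longrightarrow> R2 r = R1 r"
      using result_unlink_arc[of R1 M x] R0 unlink(1) v p x
        slots_degree_less[OF S unlink(1)]
      by (auto simp: R1_def M1_def x_def)
    obtain R3 where R3: "result w (recolour 4 12) (R2, M1) =
        (R3, M1(0 := (M1 0)(min u x * n + max u x := colour n (M1 1) (min u x) (max u x))))"
      "\<And>r. r \<notin> {6, 7, 9, 10} \<Longrightarrow> R3 r = R2 r"
      using result_recolour[of R2 4 12 M1] R0 R2(2,3) unlink(1) \<open>x \<noteq> u\<close> x(1)
        slots_less[OF S']
      by (auto simp: R1_def)
    define M2 where "M2 = M1(0 := (M1 0)(min u x * n + max u x := colour n (M1 1) (min u x) (max u x)))"
    have M21: "M2 1 = M1 1" by (simp add: M2_def)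
    obtain R4 where R4: "result w (recolour 4 5) (R3, M2) =
        (R4, M2(0 := (M2 0)(min u v * n + max u v := colour n (M1 1) (min u v) (max u v))))"
      "\<And>r. r \<notin> {6, 7, 9, 10} \<Longrightarrow> R4 r = R3 r"
      using result_recolour[of R3 4 5 M2] R0 R2(3) R3(2) unlink(1,2) v
        slots_less[OF S'] M21
      by (auto simp: R1_def)
    define M3 where "M3 = M2(0 := (M2 0)(min u v * n + max u v := colour n (M1 1) (min u v) (max u v)))"
    have "consistent n (M3(4 := (M 4)(R a := R b)))"
      unfolding consistent_def
    proof (intro conjI allI impI)
      show "slots n ((M3(4 := (M 4)(R a := R b))) 1) ((M3(4 := (M 4)(R a := R b))) 2)
          ((M3(4 := (M 4)(R a := R b))) 3)"
        using S' by (simp add: M2_def M3_def)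
    next
      fix c d assume cd: "c < n" "d < n"
      show "(M3(4 := (M 4)(R a := R b))) 1 (c * n + d) \<noteq> 0 \<longleftrightarrow>
          c \<noteq> d \<and> (M3(4 := (M 4)(R a := R b))) 4 (c * n + d) \<noteq> 0"
        using arcs[OF cd] arcs[OF unlink(1) x(1)] cd v x p unlink \<open>x \<noteq> u\<close>
        by (auto simp: M3_def M2_def M1_def addr)
    next
      fix c d assume cd: "c < d" "d < n"
      show "(M3(4 := (M 4)(R a := R b))) 0 (c * n + d) =
          colour n ((M3(4 := (M 4)(R a := R b))) 1) c d"
      proof (cases "c = min u v \<and> d = max u v \<or> c = min u x \<and> d = max u x")
        case True
        then show ?thesis using cd v x(1) unlink(1) by (auto simp: M3_def M2_def)
      next
        case False
        then have "colour n (M1 1) c d = colour n (M 1) c d"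
          using cd v x(1) unlink(1) by (intro colour_cong) (auto simp: M1_def min_def max_def)
        moreover have "M3 0 (c * n + d) = M 0 (c * n + d)"
          using False cd v x(1) unlink(1) by (auto simp: M3_def M2_def M1_def)
        ultimately show ?thesis using col[OF cd] by (simp add: M3_def M2_def)
      qed
    qed
    moreover have "result w (store_hook a b) (R, M) = (R4, M3)"
      using unlink by (simp add: pre R2(1) R3(1)[folded M2_def] R4(1) M3_def)
    moreover have "\<forall>r. r \<notin> {4..<16} \<longrightarrow> R4 r = R r"
      by (auto simp: R4(2) R3(2) R2(3) R1_def)
    moreover have "\<forall>x\<ge>4. M3 x = M x" by (simp add: M3_def M2_def M1_def)
    ultimately show ?thesis by blast
  qed
qed

lemma exec_simulate:
  assumes "exec w c s t s'"
  shows "s = simulated_state z \<Longrightarrow> good_state w n z \<Longrightarrow> fst z 0 = n \<Longrightarrow>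
    \<exists>t' z'. exec w (simulate c) z t' z' \<and> t' \<le> 80 * t \<and> s' = simulated_state z' \<and>
      good_state w n z' \<and> fst z' 0 = n"
  using assms
proof (induction arbitrary: z rule: exec.induct)
  case (Skip s)
  then show ?case using exec.Skip[of w z] by (intro exI[of _ 1] exI[of _ z]) simp
next
  case (Const r k R M)
  obtain R' M' where z: "z = (R', M')" by (cases z)
  have ex: "exec w (simulate (Const r k)) z 1 (R'(r + 16 := take_bit w k), M')"
    unfolding z simulate.simps by (rule exec.Const)
  then show ?case
    using exec_bounded[OF ex] Const
    by (intro exI[of _ 1] exI) (auto simp: z simulated_state_def good_state_def fun_eq_iff)
next
  case (Op f r a b R M)
  obtain R' M' where z: "z = (R', M')" by (cases z)
  have ex: "exec w (simulate (Op f r a b)) z 1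
      (R'(r + 16 := word_op_sem w f (R' (a + 16)) (R' (b + 16))), M')"
    unfolding z simulate.simps by (rule exec.Op)
  then show ?case
    using exec_bounded[OF ex] Op
    by (intro exI[of _ 1] exI) (auto simp: z simulated_state_def good_state_def fun_eq_iff)
next
  case (Load r x a R M)
  obtain R' M' where z: "z = (R', M')" by (cases z)
  have ex: "exec w (simulate (Load r x a)) z 1 (R'(r + 16 := M' (x + 4) (R' (a + 16))), M')"
    unfolding z simulate.simps by (rule exec.Load)
  then show ?case
    using exec_bounded[OF ex] Load
    by (intro exI[of _ 1] exI) (auto simp: z simulated_state_def good_state_def fun_eq_iff)
next
  case (Store x a b R M)
  obtain R' M' where z: "z = (R', M')" by (cases z)
  have bound: "R' (a + 16) < 2 ^ w" and cons: "consistent n M'" and R0: "R' 0 = n"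
    using Store by (auto simp: z good_state_def bounded_state_def)
  obtain R1 M1 t where hook: "exec w (if x = 0 then store_hook (a + 16) (b + 16) else Skip) z t (R1, M1)"
    and t: "t \<le> 70" and R1: "\<And>r. r \<notin> {4..<16} \<Longrightarrow> R1 r = R' r" and M1: "\<And>x. 4 \<le> x \<Longrightarrow> M1 x = M' x"
    and cons1: "consistent n (M1(x + 4 := (M1 (x + 4))(R' (a + 16) := R' (b + 16))))"
  proof (cases "x = 0")
    case True
    obtain R1 M1 where 1: "result w (store_hook (a + 16) (b + 16)) (R', M') = (R1, M1)"
      "\<And>r. r \<notin> {4..<16} \<Longrightarrow> R1 r = R' r" "\<And>x. 4 \<le> x \<Longrightarrow> M1 x = M' x"
      "consistent n (M1(4 := (M' 4)(R' (a + 16) := R' (b + 16))))"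
      using result_store_hook[OF R0 bound _ _ cons, of "b + 16"] by auto
    obtain t where "t \<le> cost (store_hook (a + 16) (b + 16))"
      "exec w (store_hook (a + 16) (b + 16)) z t (R1, M1)"
      using exec_straight[OF straight_store_hook, of "a + 16" "b + 16" w z] by (auto simp: z 1(1))
    then show ?thesis
      using cost_store_hook[of "a + 16" "b + 16"] 1(2-4) True
      by (intro that[of t R1 M1]) (auto simp: 1(3))
  next
    case False
    then show ?thesis
      using cons exec.Skip[of w z] by (intro that[of 1 R' M']) (auto simp: z consistent_fun_upd)
  qed
  define z' where "z' = (R1, M1(x + 4 := (M1 (x + 4))(R1 (a + 16) := R1 (b + 16))))"
  have ex: "exec w (simulate (Store x a b)) z (t + 1) z'"
    unfolding simulate.simps z'_def by (rule exec.Seq[OF hook exec.Store])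
  moreover have "good_state w n z'"
    using exec_bounded[OF ex] Store(2) cons1 by (auto simp: good_state_def z'_def R1)
  moreover have "(R, M(x := (M x)(R a := R b))) = simulated_state z'"
    using Store(1) by (auto simp: z z'_def simulated_state_def R1 M1 fun_eq_iff)
  moreover have "fst z' 0 = n" using R0 by (simp add: z'_def R1)
  ultimately show ?case using t by (intro exI[of _ "t + 1"] exI[of _ z']) simp
next
  case (Seq c1 s1 t1 s2 c2 t2 s3)
  obtain t1' z1 where 1: "exec w (simulate c1) z t1' z1" "t1' \<le> 80 * t1" "s2 = simulated_state z1"
    "good_state w n z1" "fst z1 0 = n"
    using Seq.IH(1)[OF Seq.prems] by blast
  obtain t2' z2 where 2: "exec w (simulate c2) z1 t2' z2" "t2' \<le> 80 * t2" "s3 = simulated_state z2"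
    "good_state w n z2" "fst z2 0 = n"
    using Seq.IH(2)[OF 1(3-5)] by blast
  show ?case
    using exec.Seq[OF 1(1) 2(1)] 1(2) 2 by (intro exI[of _ "t1' + t2'"] exI[of _ z2]) simp
next
  case (IfTrue s r c1 t s' c2)
  obtain t' z' where 1: "exec w (simulate c1) z t' z'" "t' \<le> 80 * t" "s' = simulated_state z'"
    "good_state w n z'" "fst z' 0 = n"
    using IfTrue.IH[OF IfTrue.prems] by blast
  have "fst z (r + 16) \<noteq> 0" using IfTrue.hyps(1) IfTrue.prems(1) by (simp add: simulated_state_def)
  from exec.IfTrue[where r = "r + 16", OF this 1(1)] show ?case
    using 1 by (intro exI[of _ "1 + t'"] exI[of _ z']) simp
next
  case (IfFalse s r c2 t s' c1)
  obtain t' z' where 1: "exec w (simulate c2) z t' z'" "t' \<le> 80 * t" "s' = simulated_state z'"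
    "good_state w n z'" "fst z' 0 = n"
    using IfFalse.IH[OF IfFalse.prems] by blast
  have "fst z (r + 16) = 0" using IfFalse.hyps(1) IfFalse.prems(1) by (simp add: simulated_state_def)
  from exec.IfFalse[where r = "r + 16", OF this 1(1)] show ?case
    using 1 by (intro exI[of _ "1 + t'"] exI[of _ z']) simp
next
  case (WhileFalse s r c)
  have "fst z (r + 16) = 0" using WhileFalse by (simp add: simulated_state_def)
  from exec.WhileFalse[where r = "r + 16", OF this] show ?case
    using WhileFalse by (intro exI[of _ 1] exI[of _ z]) simp
next
  case (WhileTrue s1 r c t1 s2 t2 s3)
  obtain t1' z1 where 1: "exec w (simulate c) z t1' z1" "t1' \<le> 80 * t1" "s2 = simulated_state z1"
    "good_state w n z1" "fst z1 0 = n"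
    using WhileTrue.IH(1)[OF WhileTrue.prems] by blast
  obtain t2' z2 where 2: "exec w (simulate (While r c)) z1 t2' z2" "t2' \<le> 80 * t2"
    "s3 = simulated_state z2" "good_state w n z2" "fst z2 0 = n"
    using WhileTrue.IH(2)[OF 1(3-5)] by blast
  have "fst z (r + 16) \<noteq> 0" using WhileTrue.hyps(1) WhileTrue.prems(1) by (simp add: simulated_state_def)
  from exec.WhileTrue[where r = "r + 16", OF this 1(1) 2(1)[unfolded simulate.simps]] show ?case
    using 1(2) 2 by (intro exI[of _ "1 + t1' + t2'"] exI[of _ z2]) simp
qed

end


section \<open>Maintaining the decomposition\<close>

lemma graph_after_snoc: "graph_after (us @ [x]) = apply_update (graph_after us) x"
  by (simp add: graph_after_def)

lemma valid_updates_snoc: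
  "valid_updates n (us @ [x]) \<longleftrightarrow> valid_updates n us \<and> legal_update n (graph_after us) x"
  by (auto simp: valid_updates_def less_Suc_eq nth_append)

lemma graph_after_edge:
  "valid_updates n us \<Longrightarrow> e \<in> graph_after us \<Longrightarrow> \<exists>u v. u < v \<and> v < n \<and> e = {u, v}"
proof (induction us rule: rev_induct)
  case Nil
  then show ?case by (simp add: graph_after_def)
next
  case (snoc x us)
  show ?case
  proof (cases "e \<in> graph_after us")
    case True
    then show ?thesis using snoc by (simp add: valid_updates_snoc)
  next
    case False
    then obtain u v where "x = Insert u v" "e = {u, v}"
      using snoc.prems(2) by (cases x) (auto simp: graph_after_snoc)
    then have "u < n" "v < n" "u \<noteq> v" "e = {u, v}" "e = {v, u}"
      using snoc.prems(1) by (auto simp: valid_updates_snoc)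
    then show ?thesis by (cases u v rule: linorder_cases) blast+
  qed
qed

lemma legal_update_call:
  assumes "valid_updates n (us @ [x])"
  obtains k u v where "2 \<le> n" "k \<le> 1" "u < n" "v < n"
    "\<And>s. call n x s = ((fst s)(0 := n, 1 := k, 2 := u, 3 := v), snd s)"
proof (cases x)
  case (Insert u v)
  then show ?thesis using assms by (intro that[of 1 u v]) (auto simp: valid_updates_snoc)
next
  case (Delete u v)
  then have "{u, v} \<in> graph_after us" using assms by (simp add: valid_updates_snoc)
  then have "2 \<le> n \<and> u < n \<and> v < n"
    using graph_after_edge[of n us "{u, v}"] assms by (auto simp: valid_updates_snoc doubleton_eq_iff)
  then show ?thesis using Delete by (intro that[of 0 u v]) auto
qed

definition copy_parameters :: com where
  "copy_parameters = Const 4 0 ;; Op Add 16 0 4 ;; Op Add 17 1 4 ;; Op Add 18 2 4 ;; Op Add 19 3 4"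

definition decomposition_program :: "com \<Rightarrow> com" where
  "decomposition_program A = copy_parameters ;; simulate A"

lemma cost_copy_parameters: "straight copy_parameters" "cost copy_parameters = 5"
  by (simp_all add: copy_parameters_def)

lemma good_state_init: "good_state w n init_state"
  by (simp add: good_state_def bounded_state_def consistent_def slots_def init_state_def colour_def)

lemma simulated_state_init: "simulated_state init_state = init_state"
  by (simp add: simulated_state_def init_state_def)

lemma exec_decomposition_program:
  assumes word_size: "n * n \<le> 2 ^ w" and valid: "valid_updates n (us @ [x])"
    and good: "good_state w n z"
    and exec: "exec w A (call n x (simulated_state z)) t s'"
  shows "\<exists>t' z'. exec w (decomposition_program A) (call n x z) t' z' \<and> t' \<le> 85 * t \<and>
    s' = simulated_state z' \<and> good_state w n z'"
proof -
  obtain k u v where n2: "2 \<le> n" and kuv: "k \<le> 1" "u < n" "v < n"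
    and call: "\<And>s. call n x s = ((fst s)(0 := n, 1 := k, 2 := u, 3 := v), snd s)"
    using legal_update_call[OF valid] by metis
  note small = take_bit_small[OF n2 word_size]
  define z1 where "z1 = result w copy_parameters (call n x z)"
  have z1: "z1 = ((fst z)(0 := n, 1 := k, 2 := u, 3 := v, 4 := 0, 16 := n, 17 := k, 18 := u, 19 := v), snd z)"
    unfolding z1_def call using kuv small[of n] small[of k] small[of u] small[of v] n2
    by (simp add: copy_parameters_def)
  have "bounded_state w (call n x z)"
    using good kuv n2 n_less_word[OF n2 word_size] by (auto simp: call good_state_def bounded_state_def)
  moreover obtain t0 where t0: "t0 \<le> 5" "exec w copy_parameters (call n x z) t0 z1"
    using exec_straight[of copy_parameters w "call n x z"] cost_copy_parameters
    unfolding z1_def by fastforce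
  ultimately have "good_state w n z1"
    using exec_bounded good by (auto simp: good_state_def z1)
  moreover have "call n x (simulated_state z) = simulated_state z1"
    by (auto simp: call z1 simulated_state_def fun_eq_iff)
  moreover have "fst z1 0 = n" by (simp add: z1)
  ultimately obtain t1 z' where "exec w (simulate A) z1 t1 z'" "t1 \<le> 80 * t"
    "s' = simulated_state z'" "good_state w n z'"
    using exec_simulate[OF n2 word_size exec] by blast
  then show ?thesis
    using exec.Seq[OF t0(2), of "simulate A" t1 z'] t0(1) exec_time_pos[OF exec]
    by (intro exI[of _ "t0 + t1"] exI[of _ z']) (simp add: decomposition_program_def)
qed

lemma run_decomposition_program:
  assumes "\<And>n. n * n \<le> 2 ^ w n"
  shows "run w A n us ts s \<Longrightarrow> valid_updates n us \<Longrightarrow>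
    \<exists>ts' z. run w (decomposition_program A) n us ts' z \<and> list_all2 (\<lambda>t t'. t' \<le> 85 * t) ts ts' \<and>
      s = simulated_state z \<and> good_state (w n) n z"
proof (induction rule: run.induct)
  case Nil
  show ?case
    by (intro exI[of _ "[]"] exI[of _ init_state])
      (simp add: run.Nil good_state_init simulated_state_init)
next
  case (Snoc us ts s x t s')
  obtain ts' z where 1: "run w (decomposition_program A) n us ts' z"
    "list_all2 (\<lambda>t t'. t' \<le> 85 * t) ts ts'" "s = simulated_state z" "good_state (w n) n z"
    using Snoc by (auto simp: valid_updates_snoc)
  obtain t' z' where 2: "exec (w n) (decomposition_program A) (call n x z) t' z'" "t' \<le> 85 * t"
    "s' = simulated_state z'" "good_state (w n) n z'"
    using exec_decomposition_program[OF assms Snoc.prems 1(4)] Snoc.hyps(2) 1(3) by blast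
  show ?case
    using run.Snoc[OF 1(1) 2(1)] 1(2) 2(2-4)
    by (intro exI[of _ "ts' @ [t']"] exI[of _ z']) (simp add: list_all2_appendI)
qed

lemma consistent_decomposition:
  assumes cons: "consistent n (snd z)"
    and edges: "\<And>e. e \<in> E \<Longrightarrow> \<exists>u v. u < v \<and> v < n \<and> e = {u, v}"
    and out: "outdegree_orientation d E (stored_orientation n (simulated_state z))"
  shows "arboricity_decomposition (2 * d) E (stored_forest n z)"
    and "u < v \<Longrightarrow> v < n \<Longrightarrow> {u, v} \<notin> E \<Longrightarrow> snd z 0 (u * n + v) = 0"
proof -
  define A where "A = stored_orientation n (simulated_state z)"
  define P where "P = snd z 1"
  define L where "L = snd z 2"
  have S: "slots n P L (snd z 3)"
    using cons by (simp add: consistent_def P_def L_def)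
  have A: "orientation E A" "\<And>u. card (A `` {u}) \<le> d"
    using out unfolding outdegree_orientation_def A_def by blast+
  have arcD: "(u, v) \<in> A \<Longrightarrow> {u, v} \<in> E" for u v
    using A(1) unfolding orientation_def by blast
  have edgeD: "{u, v} \<in> E \<Longrightarrow> (u, v) \<in> A \<or> (v, u) \<in> A" for u v
    using A(1) unfolding orientation_def by blast
  have no_loop: "(u, u) \<notin> A" for u
    using arcD[of u u] edges[of "{u, u}"] by auto
  have arc: "P (u * n + v) \<noteq> 0 \<longleftrightarrow> (u, v) \<in> A" if "u < n" "v < n" for u v
    using cons no_loop[of u] that
    by (auto simp: consistent_def P_def A_def stored_orientation_def simulated_state_def)
  have edge: "{u, v} \<in> E \<longleftrightarrow> P (u * n + v) \<noteq> 0 \<or> P (v * n + u) \<noteq> 0" if "u < n" "v < n" for u v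
    using arcD[of u v] arcD[of v u] edgeD[of u v] arc that by (auto simp: insert_commute)
  have P_le: "P (u * n + v) \<le> d" if "u < n" "v < n" for u v
  proof -
    have "A `` {u} = {v. v < n \<and> P (u * n + v) \<noteq> 0}"
      using arc[OF \<open>u < n\<close>] by (auto simp: A_def stored_orientation_def)
    then show ?thesis
      using slotsD(2)[OF S that] slots_degree_le_card[OF S that(1)] A(2)[of u] by simp
  qed
  have Z: "snd z 0 (u * n + v) = colour n P u v" if "u < v" "v < n" for u v
    using cons that by (simp add: consistent_def P_def)
  show "snd z 0 (u * n + v) = 0" if "u < v" "v < n" "{u, v} \<notin> E" for u v
    using that edge[of u v] by (simp add: Z colour_def)
  have "is_forest (stored_forest n z i)" for i
  proof (cases "even i")
    case True
    then obtain k where k: "i = 2 * k" by blast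
    show ?thesis
    proof (rule is_forestI[where key = "\<lambda>u. u" and h = "\<lambda>u. L (u * n + Suc k)"])
      fix e assume "e \<in> stored_forest n z i"
      then obtain u v where uv: "e = {u, v}" "u < v" "v < n" "colour n P u v = Suc i"
        using Z by (auto simp: stored_forest_def)
      then have "P (u * n + v) = Suc k"
        by (simp add: colour_def k split: if_splits) presburger+
      then have "v = L (u * n + Suc k)" using slotsD(3)[OF S, of u v] uv by simp
      with uv show "\<exists>u. e = {u, L (u * n + Suc k)} \<and> u < L (u * n + Suc k)" by blast
    qed
  next
    case False
    then obtain k where k: "i = 2 * k + 1" by (auto elim: oddE)
    show ?thesis
    proof (rule is_forestI[where key = "\<lambda>u. - int u" and h = "\<lambda>u. L (u * n + Suc k)"])
      fix e assume "e \<in> stored_forest n z i"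
      then obtain u v where uv: "e = {u, v}" "u < v" "v < n" "colour n P u v = Suc i"
        using Z by (auto simp: stored_forest_def)
      then have "P (v * n + u) = Suc k"
        by (simp add: colour_def k split: if_splits) presburger+
      then have "u = L (v * n + Suc k)" using slotsD(3)[OF S, of v u] uv by simp
      with uv show "\<exists>u. e = {u, L (u * n + Suc k)} \<and> - int u < - int (L (u * n + Suc k))"
        by (intro exI[of _ v]) (auto simp: insert_commute)
    qed
  qed
  moreover have "disjoint_family_on (stored_forest n z) {..<2 * d}"
    by (auto simp: disjoint_family_on_def stored_forest_def doubleton_eq_iff)
  moreover have "(\<Union>i<2 * d. stored_forest n z i) = E"
  proof (intro equalityI subsetI)
    fix e assume "e \<in> (\<Union>i<2 * d. stored_forest n z i)"
    then obtain i u v where "e = {u, v}" "u < v" "v < n" "colour n P u v = Suc i"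
      using Z by (auto simp: stored_forest_def)
    then show "e \<in> E" using edge[of u v] by (auto simp: colour_def split: if_splits)
  next
    fix e assume "e \<in> E"
    then obtain u v where uv: "u < v" "v < n" "e = {u, v}" using edges by blast
    have "colour n P u v \<noteq> 0" "colour n P u v \<le> 2 * d"
      using edge[of u v] uv \<open>e \<in> E\<close> P_le[of u v] P_le[of v u] by (auto simp: colour_def)
    then obtain i where "i < 2 * d" "snd z 0 (u * n + v) = Suc i"
      using Z[OF uv(1,2)] by (cases "colour n P u v") auto
    then show "e \<in> (\<Union>i<2 * d. stored_forest n z i)"
      using uv by (auto simp: stored_forest_def)
  qed
  ultimately show "arboricity_decomposition (2 * d) E (stored_forest n z)"
    by (simp add: arboricity_decomposition_def)
qed

lemma maintains_decomposition_program:
  assumes "\<And>n. n * n \<le> 2 ^ w n" and "maintains_orientation w A D"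
  shows "maintains_arboricity_decomposition w (decomposition_program A) (\<lambda>n us. 2 * D n us)"
  unfolding maintains_arboricity_decomposition_def
proof (intro allI impI)
  fix n us assume valid: "valid_updates n us"
  with assms(2) obtain ts s where "run w A n us ts s"
    and out: "outdegree_orientation (D n us) (graph_after us) (stored_orientation n s)"
    unfolding maintains_orientation_def by blast
  then obtain ts' z where run: "run w (decomposition_program A) n us ts' z"
    and z: "s = simulated_state z" "consistent n (snd z)"
    using run_decomposition_program[OF assms(1) _ valid] unfolding good_state_def by blast
  note dec = consistent_decomposition[OF z(2) graph_after_edge[OF valid] out[unfolded z(1)]]
  show "\<exists>ts z. run w (decomposition_program A) n us ts z \<and>
      arboricity_decomposition (2 * D n us) (graph_after us) (stored_forest n z) \<and>
      (\<forall>u v. u < v \<and> v < n \<and> {u, v} \<notin> graph_after us \<longrightarrow> snd z 0 (u * n + v) = 0)"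
    using run dec by blast
qed

lemma run_decomposition_program_times:
  assumes "\<And>n. n * n \<le> 2 ^ w n" and "maintains_orientation w A D"
    and "valid_updates n us" and "run w (decomposition_program A) n us ts' z"
  obtains ts s where "run w A n us ts s" "list_all2 (\<lambda>t t'. t' \<le> 85 * t) ts ts'"
proof -
  from assms(2,3) obtain ts s where run: "run w A n us ts s"
    unfolding maintains_orientation_def by blast
  from run_decomposition_program[OF assms(1) this assms(3)] run_deterministic[OF assms(4)]
  show ?thesis using that[OF run] by blast
qed

lemma length_run: "run w P n us ts s \<Longrightarrow> length ts = length us"
  by (induction rule: run.induct) auto

lemma amortized_decomposition_program:
  assumes "\<And>n. n * n \<le> 2 ^ w n" "maintains_orientation w A D" "amortized_update_time w A T"
  shows "amortized_update_time w (decomposition_program A) (\<lambda>n us. 85 * T n us)"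
  unfolding amortized_update_time_def
proof (intro allI impI, elim conjE)
  fix n us ts' z assume valid: "valid_updates n us" and "run w (decomposition_program A) n us ts' z"
  then obtain ts s where run: "run w A n us ts s" and le: "list_all2 (\<lambda>t t'. t' \<le> 85 * t) ts ts'"
    using run_decomposition_program_times[OF assms(1,2)] by blast
  from le have "sum_list ts' \<le> 85 * sum_list ts" by induction auto
  then have "real (sum_list ts') \<le> 85 * real (sum_list ts)" by linarith
  also have "real (sum_list ts) \<le> (\<Sum>i<length us. T n (take (Suc i) us))"
    using assms(3) valid run unfolding amortized_update_time_def by blast
  finally show "real (sum_list ts') \<le> (\<Sum>i<length us. 85 * T n (take (Suc i) us))"
    by (simp flip: sum_distrib_left)
qed

lemma worst_case_decomposition_program:
  assumes "\<And>n. n * n \<le> 2 ^ w n" "maintains_orientation w A D" "worst_case_update_time w A T"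
  shows "worst_case_update_time w (decomposition_program A) (\<lambda>n us. 85 * T n us)"
  unfolding worst_case_update_time_def
proof (intro allI impI, elim conjE)
  fix n us ts' z i
  assume valid: "valid_updates n us" and "run w (decomposition_program A) n us ts' z"
    and i: "i < length us"
  then obtain ts s where run: "run w A n us ts s" and le: "list_all2 (\<lambda>t t'. t' \<le> 85 * t) ts ts'"
    using run_decomposition_program_times[OF assms(1,2)] by blast
  have "ts' ! i \<le> 85 * ts ! i" using list_all2_nthD[OF le, of i] i length_run[OF run] by simp
  then have "real (ts' ! i) \<le> 85 * real (ts ! i)" by linarith
  also have "real (ts ! i) \<le> T n (take (Suc i) us)"
    using assms(3) valid run i unfolding worst_case_update_time_def by blast
  finally show "real (ts' ! i) \<le> 85 * T n (take (Suc i) us)" by simp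
qed

theorem theorem4:
  shows "\<exists>c>0::real. \<forall>(w :: nat \<Rightarrow> nat) (D :: nat \<Rightarrow> update list \<Rightarrow> nat) (T :: nat \<Rightarrow> update list \<Rightarrow> real).
    (\<forall>n. n * n \<le> 2 ^ w n) \<longrightarrow>
    ((\<exists>A. maintains_orientation w A D \<and> amortized_update_time w A T) \<longrightarrow>
      (\<exists>B. maintains_arboricity_decomposition w B (\<lambda>n us. 2 * D n us) \<and>
           amortized_update_time w B (\<lambda>n us. c * T n us))) \<and>
    ((\<exists>A. maintains_orientation w A D \<and> worst_case_update_time w A T) \<longrightarrow>
      (\<exists>B. maintains_arboricity_decomposition w B (\<lambda>n us. 2 * D n us) \<and>
           worst_case_update_time w B (\<lambda>n us. c * T n us)))"
proof (rule exI[of _ 85], intro conjI allI impI)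
  fix w :: "nat \<Rightarrow> nat" and D and T :: "nat \<Rightarrow> update list \<Rightarrow> real"
  assume w: "\<forall>n. n * n \<le> 2 ^ w n"
  show "\<exists>B. maintains_arboricity_decomposition w B (\<lambda>n us. 2 * D n us) \<and>
      amortized_update_time w B (\<lambda>n us. 85 * T n us)"
    if "\<exists>A. maintains_orientation w A D \<and> amortized_update_time w A T"
  proof -
    from that obtain A where "maintains_orientation w A D" "amortized_update_time w A T" by blast
    then show ?thesis
      using maintains_decomposition_program[of w A D] amortized_decomposition_program[of w A D T] w
      by (intro exI[of _ "decomposition_program A"]) simp
  qed
  show "\<exists>B. maintains_arboricity_decomposition w B (\<lambda>n us. 2 * D n us) \<and>
      worst_case_update_time w B (\<lambda>n us. 85 * T n us)"
    if "\<exists>A. maintains_orientation w A D \<and> worst_case_update_time w A T"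
  proof -
    from that obtain A where "maintains_orientation w A D" "worst_case_update_time w A T" by blast
    then show ?thesis
      using maintains_decomposition_program[of w A D] worst_case_decomposition_program[of w A D T] w
      by (intro exI[of _ "decomposition_program A"]) simp
  qed
qed simp

end
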